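(* Let $T:\mathbb{R}\to B(\mathcal{H})$ be the $C_0$-group generated by $L$, and let $k\in\mathbb{Z}_+$, $U=I+W\in B(\mathcal{H})$ continuously invertible with $W\in\mathfrak{S}_2(\mathcal{H},\mathcal{P})$, $B_{(k)}\in B(\mathcal{H}_{(k)})$ and $B_\ell\in B(\mathcal{H}_\ell)$, $|\ell|>k$, with $\sum_{|\ell|>k}\|B_\ell\|^2<\infty$, be such that $$U^{-1}T(t)U=\Big(\bigoplus_{\ell=-\infty}^{-k-1}e^{t(\frac{i2\pi\ell}{\omega}I_\ell+B_\ell)}\Big)\oplus e^{tB_{(k)}}\oplus\Big(\bigoplus_{\ell=k+1}^{\infty}e^{t(\frac{i2\pi\ell}{\omega}I_\ell+B_\ell)}\Big),\quad t\in\mathbb{R}.$$ For $|\ell|\ge k+1$ put $\beta_\ell=\|P_\ell W\|_{2,\mathcal{P}}$ and $\gamma_\ell=\|B_\ell\|$, and for $\ell\ge k+1$ put $\kappa_\ell=\sup_{|n|\ge\ell}\|B_n\|$. Then for any $\psi\in L^2$ there is a constant $C>0$, independent of $n$, such that for each $n>k$ and all $t\in\mathbb{R}$ $$\Big\|T(t)U\psi-Ue^{tB_{(k)}}P_{(k)}\psi-\sum_{k<|\ell|\le n}Ue^{(\frac{i2\pi\ell}{\omega}I_\ell+B_\ell)t}P_\ell\psi\Big\|_2\le C\Big(\sum_{|\ell|\ge n+1}e^{2\gamma_\ell|t|}\big(|\widehat{\psi}(\ell)|^2+\beta_\ell^2\|\psi\|^2\big)\Big)^{1/2}$$ $$\le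 Ce^{\kappa_{n+1}|t|}\Big(\sum_{|\ell|\ge n+1}\big(|\widehat{\psi}(\ell)|^2+\beta_\ell^2\|\psi\|^2\big)\Big)^{1/2}.$$
   Context: Setting. Let $\omega>0$, let $H$ be a complex Hilbert space, and let $\mathcal{H}=L^2=L^2([0,\omega],H)$ with inner product $\langle x,y\rangle=\frac1\omega\int_0^\omega\langle x(s),y(s)\rangle_H\,ds$; both $\|\psi\|$ and $\|\cdot\|_2$ of elements of $L^2$ denote the corresponding norm. $W_2^1$ is the Sobolev space of continuous functions in $L^2$ with derivative in $L^2$. Let $\mathcal{V}:[0,\omega]\to B(H)$ be strongly measurable with $s\mapsto\mathcal{V}(s)x$ in $L^2$ for every $x\in H$, and let $\widehat{\mathcal{V}}(n)x=\frac1\omega\int_0^\omega\mathcal{V}(s)x\,e^{-i2\pi ns/\omega}ds$, $n\in\mathbb{Z}$. Assume $\sum_{n\in\mathbb{Z}}\|\widehat{\mathcal{V}}(n)\|^2<\infty$ and $\sum_{j,\ell\in\mathbb{Z}}\big\|\sum_{n\neq\ell}\frac{\widehat{\mathcal{V}}(j+n)\widehat{\mathcal{V}}(\ell+n)}{\ell-n}\big\|^2<\infty$. Let $L_0=\frac{d}{ds}$ with domain $D(L_0)=\{y\in W_2^1: y(0)=y(\omega)\}$, $(Vy)(s)=\mathcal{V}(s)y(\omega-s)$ for $y\in D(L_0)$, and $L=L_0-V$ with $D(L)=D(L_0)$. (It is known that $L$ generates a $C_0$-group and that $k,U,B_{(k)},B_\ell$ as in the claim exist.) Projections. For $\ell\in\mathbb{Z}$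 let $(P_\ell x)(s)=\widehat{x}(\ell)e^{i2\pi\ell s/\omega}$, $\widehat{x}(\ell)=\frac1\omega\int_0^\omega x(\tau)e^{-i2\pi\ell\tau/\omega}d\tau\in H$, $|\widehat{x}(\ell)|$ the norm of $\widehat{x}(\ell)$ in $H$, $\mathcal{H}_\ell=\mathrm{Im}\,P_\ell$, $I_\ell$ the identity on $\mathcal{H}_\ell$, $\mathcal{P}=\{P_\ell:\ell\in\mathbb{Z}\}$, and for $m\in\mathbb{Z}_+=\mathbb{N}\cup\{0\}$ let $P_{(m)}=\sum_{|\ell|\le m}P_\ell$, $\mathcal{H}_{(m)}=\mathrm{Im}\,P_{(m)}$. $\mathfrak{S}_2(\mathcal{H},\mathcal{P})$ is the set of $X\in B(\mathcal{H})$ with $\|X\|_{2,\mathcal{P}}^2=\sum_{j,\ell\in\mathbb{Z}}\|P_jXP_\ell\|^2<\infty$ (operator norms inside the sum). *)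

theory Defs
  imports "HOL-Analysis.Analysis"
begin

section \<open>Complex Hilbert spaces and bounded operators\<close>

text \<open>Not assumed separable. The complex inner product is linear in the first argument; its real
  part is the inner product of \<^class>\<open>real_inner\<close>, so that \<open>norm x = sqrt (Re (cinner x x))\<close>.\<close>

class complex_hilbert = real_inner + banach +
  fixes scaleC :: "complex \<Rightarrow> 'a \<Rightarrow> 'a" (infixr "*\<^sub>C" 75)
    and cinner :: "'a \<Rightarrow> 'a \<Rightarrow> complex"
  assumes scaleC_add_right: "c *\<^sub>C (x + y) = c *\<^sub>C x + c *\<^sub>C y"
    and scaleC_add_left: "(c + d) *\<^sub>C x = c *\<^sub>C x + d *\<^sub>C x"
    and scaleC_scaleC: "c *\<^sub>C d *\<^sub>C x = (c * d) *\<^sub>C x"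
    and scaleR_scaleC: "r *\<^sub>R x = complex_of_real r *\<^sub>C x"
    and cinner_commute: "cinner x y = cnj (cinner y x)"
    and cinner_add_left: "cinner (x + y) z = cinner x z + cinner y z"
    and cinner_scaleC_left: "cinner (c *\<^sub>C x) y = c * cinner x y"
    and inner_eq_Re_cinner: "inner x y = Re (cinner x y)"

text \<open>\<open>A \<in> B(S)\<close> for a subspace \<open>S\<close>; the values of \<open>A\<close> outside \<open>S\<close> are irrelevant.\<close>

definition bounded_clinear_on :: "'a::complex_hilbert set \<Rightarrow> ('a \<Rightarrow> 'a) \<Rightarrow> bool" where
  "bounded_clinear_on S A \<longleftrightarrow>
     (\<forall>x\<in>S. A x \<in> S) \<and>
     (\<forall>x\<in>S. \<forall>y\<in>S. A (x + y) = A x + A y) \<and>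
     (\<forall>c. \<forall>x\<in>S. A (c *\<^sub>C x) = c *\<^sub>C A x) \<and>
     (\<exists>K. \<forall>x\<in>S. norm (A x) \<le> K * norm x)"

text \<open>The operator norm in \<open>B(S)\<close>; for \<open>S = UNIV\<close> this is \<^const>\<open>onorm\<close>.\<close>

definition onorm_on :: "'a::complex_hilbert set \<Rightarrow> ('a \<Rightarrow> 'a) \<Rightarrow> real" where
  "onorm_on S A = (SUP x\<in>S. norm (A x) / norm x)"

text \<open>The exponential series \<open>e\<^sup>A\<close>, evaluated at a point of the space on which \<open>A\<close> is bounded
  (there the series converges absolutely).\<close>

definition op_exp :: "('a::complex_hilbert \<Rightarrow> 'a) \<Rightarrow> 'a \<Rightarrow> 'a" where
  "op_exp A x = (\<Sum>n. (A ^^ n) x /\<^sub>R fact n)"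

definition continuously_invertible :: "('a::complex_hilbert \<Rightarrow> 'a) \<Rightarrow> bool" where
  "continuously_invertible U \<longleftrightarrow>
     bounded_clinear_on UNIV U \<and> bij U \<and> bounded_clinear_on UNIV (inv U)"

definition C0_group :: "(real \<Rightarrow> 'a::complex_hilbert \<Rightarrow> 'a) \<Rightarrow> bool" where
  "C0_group T \<longleftrightarrow>
     (\<forall>t. bounded_clinear_on UNIV (T t)) \<and> T 0 = id \<and> (\<forall>s t. T (s + t) = T s \<circ> T t) \<and>
     (\<forall>x. continuous_on UNIV (\<lambda>t. T t x))"

text \<open>Unbounded operators are given by their graphs.\<close>

definition generator_graph :: "(real \<Rightarrow> 'a::complex_hilbert \<Rightarrow> 'a) \<Rightarrow> ('a \<times> 'a) set" where
  "generator_graph T = {(x, y). ((\<lambda>t. (T t x - x) /\<^sub>R t) \<longlongrightarrow> y) (at 0)}"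


section \<open>Square integrable functions on an interval\<close>

text \<open>Strong measurability in the sense of Bochner. Vector-valued integrals below are
  Henstock--Kurzweil integrals, because the Bochner integral of the library needs a second
  countable range. They are only applied to strongly measurable functions with integrable norm,
  where both integrals exist and agree.\<close>

definition strongly_measurable :: "'b measure \<Rightarrow> ('b \<Rightarrow> 'a::real_normed_vector) \<Rightarrow> bool" where
  "strongly_measurable M f \<longleftrightarrow>
     (\<exists>s. (\<forall>i. simple_function M (s i)) \<and> (AE x in M. (\<lambda>i::nat. s i x) \<longlonglongrightarrow> f x))"

definition L2_fun :: "real \<Rightarrow> (real \<Rightarrow> 'h::complex_hilbert) set" where
  "L2_fun \<omega> = {f. strongly_measurable (lebesgue_on {0..\<omega>}) f \<and>
                 (\<lambda>s. (norm (f s))\<^sup>2) integrable_on {0..\<omega>}}"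

text \<open>The type \<open>'l\<close> is the Hilbert space \<open>L\<^sup>2([0,\<omega>],H)\<close> and \<open>Q\<close> the map sending a square
  integrable function to its class. A type cannot depend on \<open>\<omega>\<close>, so the space of classes is
  given by its quotient map: linear, onto, and carrying the inner product
  \<open>(1/\<omega>) \<integral>\<^sub>0\<^sup>\<omega> \<langle>f(s),g(s)\<rangle> ds\<close>. In particular \<open>Q f = Q g\<close> iff \<open>f = g\<close> almost everywhere on
  \<open>[0,\<omega>]\<close>, and \<open>('l, Q)\<close> is unique up to a unique unitary isomorphism. Completeness of \<open>'l\<close> is no
  additional restriction (Riesz--Fischer). One type \<open>'l\<close> serves every \<open>\<omega> > 0\<close>: take classes of
  functions on \<open>[0,1]\<close> and let \<open>Q f\<close> be the class of \<open>\<sigma> \<mapsto> f(\<omega>\<sigma>)\<close>. The values of \<open>Q\<close> outside \<^const>\<open>L2_fun\<close> are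
  irrelevant.\<close>

definition L2_quotient :: "real \<Rightarrow> ((real \<Rightarrow> 'h::complex_hilbert) \<Rightarrow> 'l::complex_hilbert) \<Rightarrow> bool" where
  "L2_quotient \<omega> Q \<longleftrightarrow>
     Q ` L2_fun \<omega> = UNIV \<and>
     (\<forall>f\<in>L2_fun \<omega>. \<forall>g\<in>L2_fun \<omega>. Q (\<lambda>s. f s + g s) = Q f + Q g) \<and>
     (\<forall>c. \<forall>f\<in>L2_fun \<omega>. Q (\<lambda>s. c *\<^sub>C f s) = c *\<^sub>C Q f) \<and>
     (\<forall>f\<in>L2_fun \<omega>. \<forall>g\<in>L2_fun \<omega>.
        cinner (Q f) (Q g) = (1 / \<omega>) *\<^sub>R integral {0..\<omega>} (\<lambda>s. cinner (f s) (g s)))"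


section \<open>Fourier coefficients and the spectral projections\<close>

definition fourier_fun :: "real \<Rightarrow> (real \<Rightarrow> 'h::complex_hilbert) \<Rightarrow> int \<Rightarrow> 'h" where
  "fourier_fun \<omega> f n =
     (1 / \<omega>) *\<^sub>R integral {0..\<omega>} (\<lambda>s. cis (- (2 * pi * of_int n * s / \<omega>)) *\<^sub>C f s)"

text \<open>The coefficient of a class is computed from any representative.\<close>

definition fourier ::
  "real \<Rightarrow> ((real \<Rightarrow> 'h::complex_hilbert) \<Rightarrow> 'l::complex_hilbert) \<Rightarrow> 'l \<Rightarrow> int \<Rightarrow> 'h" where
  "fourier \<omega> Q x = fourier_fun \<omega> (inv_into (L2_fun \<omega>) Q x)"

definition Proj ::
  "real \<Rightarrow> ((real \<Rightarrow> 'h::complex_hilbert) \<Rightarrow> 'l::complex_hilbert) \<Rightarrow> int \<Rightarrow> 'l \<Rightarrow> 'l" where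
  "Proj \<omega> Q l x = Q (\<lambda>s. cis (2 * pi * of_int l * s / \<omega>) *\<^sub>C fourier \<omega> Q x l)"

definition Proj_upto ::
  "real \<Rightarrow> ((real \<Rightarrow> 'h::complex_hilbert) \<Rightarrow> 'l::complex_hilbert) \<Rightarrow> nat \<Rightarrow> 'l \<Rightarrow> 'l" where
  "Proj_upto \<omega> Q m x = (\<Sum>l \<in> {l. \<bar>l\<bar> \<le> int m}. Proj \<omega> Q l x)"

definition S2 ::
  "real \<Rightarrow> ((real \<Rightarrow> 'h::complex_hilbert) \<Rightarrow> 'l::complex_hilbert) \<Rightarrow> ('l \<Rightarrow> 'l) set" where
  "S2 \<omega> Q = {X. bounded_clinear_on UNIV X \<and>
     (\<lambda>(j, l). (onorm (Proj \<omega> Q j \<circ> X \<circ> Proj \<omega> Q l))\<^sup>2) summable_on UNIV}"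

definition S2_norm ::
  "real \<Rightarrow> ((real \<Rightarrow> 'h::complex_hilbert) \<Rightarrow> 'l::complex_hilbert) \<Rightarrow> ('l \<Rightarrow> 'l) \<Rightarrow> real" where
  "S2_norm \<omega> Q X = sqrt (\<Sum>\<^sub>\<infinity>(j, l). (onorm (Proj \<omega> Q j \<circ> X \<circ> Proj \<omega> Q l))\<^sup>2)"


section \<open>The differential operator with involution\<close>

definition Vhat :: "real \<Rightarrow> (real \<Rightarrow> 'h::complex_hilbert \<Rightarrow> 'h) \<Rightarrow> int \<Rightarrow> 'h \<Rightarrow> 'h" where
  "Vhat \<omega> \<V> n x = fourier_fun \<omega> (\<lambda>s. \<V> s x) n"

text \<open>The operators \<^term>\<open>Vhat \<omega> \<V> n\<close> are automatically bounded (closed graph theorem), and under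
  the first summability condition the inner sum of the second one converges absolutely in operator
  norm (Cauchy--Schwarz).\<close>

definition admissible_potential :: "real \<Rightarrow> (real \<Rightarrow> 'h::complex_hilbert \<Rightarrow> 'h) \<Rightarrow> bool" where
  "admissible_potential \<omega> \<V> \<longleftrightarrow>
     (\<forall>s\<in>{0..\<omega>}. bounded_clinear_on UNIV (\<V> s)) \<and>
     (\<forall>x. (\<lambda>s. \<V> s x) \<in> L2_fun \<omega>) \<and>
     (\<lambda>n. (onorm (Vhat \<omega> \<V> n))\<^sup>2) summable_on UNIV \<and>
     (\<lambda>(j, l). (onorm (\<lambda>x. \<Sum>\<^sub>\<infinity>n\<in>{n. n \<noteq> l}.
         Vhat \<omega> \<V> (j + n) (Vhat \<omega> \<V> (l + n) x) /\<^sub>R of_int (l - n)))\<^sup>2) summable_on UNIV"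

text \<open>\<open>y \<in> W\<^sub>2\<^sup>1\<close> with derivative \<open>y' \<in> L\<^sup>2\<close>, in the Sobolev sense: \<open>y\<close> is the primitive of \<open>y'\<close>.\<close>

definition W21_deriv ::
  "real \<Rightarrow> (real \<Rightarrow> 'h::complex_hilbert) \<Rightarrow> (real \<Rightarrow> 'h) \<Rightarrow> bool" where
  "W21_deriv \<omega> y y' \<longleftrightarrow>
     continuous_on {0..\<omega>} y \<and> y \<in> L2_fun \<omega> \<and> y' \<in> L2_fun \<omega> \<and>
     (\<forall>s\<in>{0..\<omega>}. y s = y 0 + integral {0..s} y')"

definition L_graph ::
  "real \<Rightarrow> ((real \<Rightarrow> 'h::complex_hilbert) \<Rightarrow> 'l::complex_hilbert) \<Rightarrow>
   (real \<Rightarrow> 'h \<Rightarrow> 'h) \<Rightarrow> ('l \<times> 'l) set" where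
  "L_graph \<omega> Q \<V> =
     {(Q y, Q y' - Q (\<lambda>s. \<V> s (y (\<omega> - s)))) | y y'. W21_deriv \<omega> y y' \<and> y 0 = y \<omega>}"


section \<open>Block diagonal groups\<close>

definition mode_exp ::
  "real \<Rightarrow> (int \<Rightarrow> 'l::complex_hilbert \<Rightarrow> 'l) \<Rightarrow> real \<Rightarrow> int \<Rightarrow> 'l \<Rightarrow> 'l" where
  "mode_exp \<omega> B t l =
     op_exp (\<lambda>x. t *\<^sub>R (Complex 0 (2 * pi * of_int l / \<omega>) *\<^sub>C x + B l x))"

text \<open>The direct sum of operators on the pairwise orthogonal spaces \<open>\<H>\<^sub>l\<close> (\<open>\<bar>l\<bar> > k\<close>) and
  \<open>\<H>\<^sub>(\<^sub>k\<^sub>)\<close>, whose closed span is the whole space. If \<open>\<parallel>B\<^sub>l\<parallel>\<close> is bounded, the two infinite sums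
  converge for all \<open>x\<close>.\<close>

definition block_group ::
  "real \<Rightarrow> ((real \<Rightarrow> 'h::complex_hilbert) \<Rightarrow> 'l::complex_hilbert) \<Rightarrow>
   nat \<Rightarrow> ('l \<Rightarrow> 'l) \<Rightarrow> (int \<Rightarrow> 'l \<Rightarrow> 'l) \<Rightarrow> real \<Rightarrow> 'l \<Rightarrow> 'l" where
  "block_group \<omega> Q k Bk B t x =
     (\<Sum>\<^sub>\<infinity>l\<in>{..- int k - 1}. mode_exp \<omega> B t l (Proj \<omega> Q l x)) +
     op_exp (\<lambda>y. t *\<^sub>R Bk y) (Proj_upto \<omega> Q k x) +
     (\<Sum>\<^sub>\<infinity>l\<in>{int k + 1..}. mode_exp \<omega> B t l (Proj \<omega> Q l x))"

end

theory Submission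
  imports Defs
begin

text \<open>The difference is \<open>U\<close> applied to the tail \<open>\<Sum>\<^bsub>|l|>n\<^esub> e\<^bsup>t(2\<pi>il/\<omega> + B(l))\<^esup> P\<^sub>l \<psi>\<close> of the block
  diagonal group. The summands are mutually orthogonal, and since the scalar \<open>2\<pi>il/\<omega>\<close> commutes with \<open>B\<^sub>l\<close> and its
  exponential has modulus one, the \<open>l\<close>-th summand has norm at most \<open>e\<^bsup>\<gamma>(l)|t|\<^esup> |\<psi>^(l)|\<close>. Pythagoras
  gives the first estimate with \<open>C = \<parallel>U\<parallel> + 1\<close>; the terms with \<open>\<beta>\<^sub>l\<close> only enlarge the bound, but
  they have to be square summable, since a divergent \<open>\<Sum>\<^sub>\<infinity>\<close> is \<open>0\<close> by convention.\<close>

section \<open>Complex inner products and orthogonal series\<close>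

lemma cinner_add_right: "cinner x (y + z) = cinner x y + cinner x z"
  by (metis cinner_add_left cinner_commute complex_cnj_add)

lemma cinner_scaleC_right: "cinner x (c *\<^sub>C y) = cnj c * cinner x y"
  by (metis cinner_scaleC_left cinner_commute complex_cnj_mult)

lemma scaleC_one: "1 *\<^sub>C x = x"
  using scaleR_scaleC[of 1 x] by simp

lemma cinner_self: "cinner x x = complex_of_real ((norm x)\<^sup>2)"
proof -
  have "Im (cinner x x) = 0"
    using cinner_commute[of x x] by (metis complex_cnj_cancel_iff Reals_cnj_iff complex_is_Real_iff)
  then show ?thesis
    by (simp add: complex_eq_iff power2_norm_eq_inner inner_eq_Re_cinner)
qed

lemma norm_scaleC: "norm (c *\<^sub>C x) = cmod c * norm x"
proof -
  have "complex_of_real ((norm (c *\<^sub>C x))\<^sup>2) = c * cnj c * complex_of_real ((norm x)\<^sup>2)"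
    by (simp only: cinner_self[symmetric] cinner_scaleC_left cinner_scaleC_right mult_ac)
  also have "\<dots> = complex_of_real ((cmod c * norm x)\<^sup>2)"
    by (simp add: complex_norm_square[symmetric] power_mult_distrib)
  finally have "(norm (c *\<^sub>C x))\<^sup>2 = (cmod c * norm x)\<^sup>2"
    by (simp only: of_real_eq_iff)
  then show ?thesis by (simp add: power2_eq_iff_nonneg)
qed

text \<open>Rotating \<open>x\<close> by the unimodular factor \<open>c\<close> makes the inner
  product real and nonnegative, so the real Cauchy-Schwarz inequality applies. If the inner product
  vanishes, then \<open>c = 0\<close> and the argument still works.\<close>

lemma cmod_cinner_le: "cmod (cinner x y) \<le> norm x * norm y"
proof -
  define c where "c = cnj (sgn (cinner x y))"
  have "c * cinner x y = complex_of_real (cmod (cinner x y))"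
    by (simp add: c_def sgn_div_norm complex_norm_square[symmetric] scaleR_conv_of_real
      power2_eq_square mult.commute[of "cnj _"] field_simps)
  then have "cmod (cinner x y) = inner (c *\<^sub>C x) y"
    by (simp add: inner_eq_Re_cinner cinner_scaleC_left)
  also have "\<dots> \<le> norm (c *\<^sub>C x) * norm y" by (rule norm_cauchy_schwarz)
  also have "\<dots> \<le> norm x * norm y"
    by (intro mult_right_mono) (simp_all add: norm_scaleC c_def norm_sgn)
  finally show ?thesis .
qed

text \<open>This form, and its analogue for \<open>cinner\<close>, supplies limits, finite sums and
  differences in either variable through the interpretations below.\<close>

lemma bounded_bilinear_scaleC: "bounded_bilinear (scaleC :: complex \<Rightarrow> 'a::complex_hilbert \<Rightarrow> 'a)"
proof
  show "\<exists>K. \<forall>c (x :: 'a). norm (c *\<^sub>C x) \<le> cmod c * norm x * K"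
    by (rule exI[of _ 1]) (simp add: norm_scaleC)
qed (simp_all add: scaleC_add_left scaleC_add_right scaleR_scaleC scaleC_scaleC scaleR_conv_of_real mult.commute)

lemma bounded_bilinear_cinner: "bounded_bilinear (cinner :: 'a::complex_hilbert \<Rightarrow> 'a \<Rightarrow> complex)"
proof
  show "\<exists>K. \<forall>x (y :: 'a). cmod (cinner x y) \<le> norm x * norm y * K"
    by (rule exI[of _ 1]) (simp add: cmod_cinner_le)
qed (simp_all add: cinner_add_left cinner_add_right scaleR_scaleC cinner_scaleC_left
    cinner_scaleC_right scaleR_conv_of_real)

interpretation scaleC: bounded_bilinear "scaleC :: complex \<Rightarrow> 'a::complex_hilbert \<Rightarrow> 'a"
  by (rule bounded_bilinear_scaleC)

interpretation cinner: bounded_bilinear "cinner :: 'a::complex_hilbert \<Rightarrow> 'a \<Rightarrow> complex"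
  by (rule bounded_bilinear_cinner)

lemma cinner_ext:
  assumes "\<And>z. cinner x z = cinner y z"
  shows "x = y"
proof -
  have "cinner (x - y) (x - y) = 0" by (simp only: cinner.diff_left assms diff_self)
  then show ?thesis by (simp add: cinner_self)
qed

lemma bounded_clinear_on_UNIV_imp_bounded_linear:
  assumes "bounded_clinear_on UNIV A"
  shows "bounded_linear A"
proof -
  obtain K where "\<And>x. norm (A x) \<le> K * norm x"
    using assms unfolding bounded_clinear_on_def by auto
  with assms show ?thesis
    unfolding bounded_clinear_on_def
    by (intro bounded_linear_intro[of A K]) (auto simp: scaleR_scaleC mult.commute)
qed

text \<open>By Pythagoras a finite partial sum has as squared norm the partial sum of the squared
  norms. Convergence of the latter makes the net of partial sums Cauchy, and completeness gives the
  limit. The identity for the norms then passes to the limit by continuity.\<close>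

lemma orthogonal_summable_on:
  fixes v :: "'i \<Rightarrow> 'a::{real_inner,banach}"
  assumes orth: "pairwise (\<lambda>i j. orthogonal (v i) (v j)) A"
    and sq: "(\<lambda>i. (norm (v i))\<^sup>2) summable_on A"
  shows "v summable_on A"
    and "(norm (infsum v A))\<^sup>2 = (\<Sum>\<^sub>\<infinity>i\<in>A. (norm (v i))\<^sup>2)"
proof -
  let ?q = "\<lambda>i. (norm (v i))\<^sup>2"
  have pyth: "(norm (sum v F))\<^sup>2 = sum ?q F" if "finite F" "F \<subseteq> A" for F
    using that orth by (intro norm_sum_Pythagorean) (auto intro: pairwise_subset)
  have tail: "sum ?q F \<le> infsum ?q A - sum ?q P"
    if "finite F" "finite P" "F \<subseteq> A" "P \<subseteq> A" "F \<inter> P = {}" for F P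
  proof -
    have "sum ?q F + sum ?q P = sum ?q (F \<union> P)" using that by (simp add: sum.union_disjoint)
    also have "\<dots> \<le> infsum ?q A" using that by (intro finite_sum_le_infsum sq) auto
    finally show ?thesis by simp
  qed
  \<comment> \<open>The Cauchy criterion asks for an eventual property of finite sets under which
    any two partial sums are close. The property is to contain a finite set that leaves less than
    \<open>(e / 2)^2\<close> of the total of the squares; each such sum is then within
    \<open>e / 2\<close> of the sum over that set.\<close>
  have "\<exists>P. eventually P (finite_subsets_at_top A) \<and> (\<forall>F F'. P F \<and> P F' \<longrightarrow> dist (sum v F) (sum v F') < e)"
    if e: "e > 0" for e
  proof -
    have "(sum ?q \<longlongrightarrow> infsum ?q A) (finite_subsets_at_top A)"
      using has_sum_infsum[OF sq] by (simp add: has_sum_def)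
    then have "\<forall>\<^sub>F P in finite_subsets_at_top A. dist (sum ?q P) (infsum ?q A) < (e / 2)\<^sup>2"
      using e by (intro tendstoD) auto
    moreover have "\<forall>\<^sub>F P in finite_subsets_at_top A. finite P \<and> P \<subseteq> A"
      by (auto intro: eventually_finite_subsets_at_top_weakI)
    ultimately obtain P where P: "dist (sum ?q P) (infsum ?q A) < (e / 2)\<^sup>2" "finite P" "P \<subseteq> A"
      using eventually_happens'[OF finite_subsets_at_top_neq_bot eventually_conj] by blast
    have close: "dist (sum v F) (sum v P) < e / 2" if "finite F" "F \<subseteq> A" "P \<subseteq> F" for F
    proof -
      have "(dist (sum v F) (sum v P))\<^sup>2 = sum ?q (F - P)"
        using pyth[of "F - P"] that P(2) by (auto simp: dist_norm sum_diff)
      also have "\<dots> \<le> infsum ?q A - sum ?q P" using that P by (intro tail) auto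
      also have "\<dots> < (e / 2)\<^sup>2" using P(1) by (simp add: dist_real_def)
      finally show ?thesis by (rule power_less_imp_less_base) (use e in simp)
    qed
    show ?thesis
    proof (intro exI conjI allI impI)
      show "\<forall>\<^sub>F F in finite_subsets_at_top A. finite F \<and> F \<subseteq> A \<and> P \<subseteq> F"
        using P by (auto simp: eventually_finite_subsets_at_top)
      show "dist (sum v F) (sum v F') < e"
        if "(finite F \<and> F \<subseteq> A \<and> P \<subseteq> F) \<and> (finite F' \<and> F' \<subseteq> A \<and> P \<subseteq> F')" for F F'
        using dist_triangle_half_l[OF close close] that by auto
    qed
  qed
  then have "cauchy_filter (filtermap (sum v) (finite_subsets_at_top A))"
    by (simp add: cauchy_filter_metric_filtermap)
  then obtain L where "(sum v \<longlongrightarrow> L) (finite_subsets_at_top A)"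
    using cauchy_filter_complete_converges[of "filtermap (sum v) (finite_subsets_at_top A)" UNIV]
      complete_UNIV by (auto simp: filterlim_def filtermap_bot_iff)
  then show sm: "v summable_on A"
    by (auto simp: summable_on_def has_sum_def)
  have "((\<lambda>F. (norm (sum v F))\<^sup>2) \<longlongrightarrow> (norm (infsum v A))\<^sup>2) (finite_subsets_at_top A)"
    using has_sum_infsum[OF sm] by (intro tendsto_intros) (simp add: has_sum_def)
  moreover have "\<forall>\<^sub>F F in finite_subsets_at_top A. (norm (sum v F))\<^sup>2 = sum ?q F"
    by (rule eventually_finite_subsets_at_top_weakI) (rule pyth)
  ultimately have "(sum ?q \<longlongrightarrow> (norm (infsum v A))\<^sup>2) (finite_subsets_at_top A)"
    by (rule Lim_transform_eventually)
  then have "(?q has_sum (norm (infsum v A))\<^sup>2) A" unfolding has_sum_def .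
  then show "(norm (infsum v A))\<^sup>2 = infsum ?q A" by (rule infsumI[symmetric])
qed

section \<open>Integrability of strongly measurable functions\<close>

text \<open>Riemann sums of \<open>f\<close> and \<open>g\<close> over the same division differ in
  norm by at most the Riemann sum of \<open>norm (f x - g x)\<close>, and a fine division brings
  that below its integral plus \<open>e / 8\<close>. So the Cauchy criterion for \<open>g\<close>
  carries over to \<open>f\<close>, with an error \<open>e / 4\<close> from each of the two
  divisions and \<open>e / 4\<close> from \<open>g\<close>.\<close>

lemma integrable_on_if_L1_approximable:
  fixes f :: "'n::euclidean_space \<Rightarrow> 'a::banach"
  assumes approx: "\<And>e. e > 0 \<Longrightarrow> \<exists>g. g integrable_on cbox a b \<and>
      (\<lambda>x. norm (f x - g x)) integrable_on cbox a b \<and>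
      integral (cbox a b) (\<lambda>x. norm (f x - g x)) < e"
  shows "f integrable_on cbox a b"
  unfolding integrable_Cauchy
proof (intro allI impI)
  fix e :: real assume e: "e > 0"
  obtain g where g: "g integrable_on cbox a b"
    and h: "(\<lambda>x. norm (f x - g x)) integrable_on cbox a b"
    and small: "integral (cbox a b) (\<lambda>x. norm (f x - g x)) < e / 8"
    using approx[of "e / 8"] e by auto
  let ?S = "\<lambda>(\<phi> :: 'n \<Rightarrow> 'a) D. \<Sum>(x, K)\<in>D. measure lborel K *\<^sub>R \<phi> x"
  obtain \<gamma>1 where \<gamma>1: "gauge \<gamma>1"
    "\<And>D1 D2. \<lbrakk>D1 tagged_division_of cbox a b; \<gamma>1 fine D1; D2 tagged_division_of cbox a b; \<gamma>1 fine D2\<rbrakk>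
       \<Longrightarrow> norm (?S g D1 - ?S g D2) < e / 4"
    using g[unfolded integrable_Cauchy, rule_format, of "e / 4"] e by auto
  obtain \<gamma>2 where \<gamma>2: "gauge \<gamma>2"
    "\<And>D. \<lbrakk>D tagged_division_of cbox a b; \<gamma>2 fine D\<rbrakk> \<Longrightarrow>
      norm ((\<Sum>(x, K)\<in>D. measure lborel K *\<^sub>R norm (f x - g x))
        - integral (cbox a b) (\<lambda>x. norm (f x - g x))) < e / 8"
    using integrable_integral[OF h, unfolded has_integral, rule_format, of "e / 8"] e by auto
  have close: "norm (?S f D - ?S g D) < e / 4"
    if D: "D tagged_division_of cbox a b" "\<gamma>2 fine D" for D
  proof -
    have "norm (?S f D - ?S g D) = norm (\<Sum>(x, K)\<in>D. measure lborel K *\<^sub>R (f x - g x))"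
      by (simp add: sum_subtractf[symmetric] case_prod_unfold scaleR_diff_right)
    also have "\<dots> \<le> (\<Sum>(x, K)\<in>D. measure lborel K *\<^sub>R norm (f x - g x))"
      by (rule sum_norm_le) (auto simp: case_prod_unfold)
    also have "\<dots> < e / 4"
      using \<gamma>2(2)[OF D] small unfolding real_norm_def by linarith
    finally show ?thesis .
  qed
  show "\<exists>\<gamma>. gauge \<gamma> \<and> (\<forall>D1 D2. D1 tagged_division_of cbox a b \<and> \<gamma> fine D1 \<and>
      D2 tagged_division_of cbox a b \<and> \<gamma> fine D2 \<longrightarrow> norm (?S f D1 - ?S f D2) < e)"
  proof (intro exI conjI allI impI)
    show "gauge (\<lambda>x. \<gamma>1 x \<inter> \<gamma>2 x)" using \<gamma>1(1) \<gamma>2(1) by (rule gauge_Int)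
    fix D1 D2
    assume D: "D1 tagged_division_of cbox a b \<and> (\<lambda>x. \<gamma>1 x \<inter> \<gamma>2 x) fine D1 \<and>
      D2 tagged_division_of cbox a b \<and> (\<lambda>x. \<gamma>1 x \<inter> \<gamma>2 x) fine D2"
    then have "norm (?S f D1 - ?S g D1) < e / 4" "norm (?S f D2 - ?S g D2) < e / 4"
      "norm (?S g D1 - ?S g D2) < e / 4"
      using close \<gamma>1(2) by (auto simp: fine_Int)
    moreover have "norm (x - y) \<le> norm (x - u) + norm (y - v) + norm (u - v)" for x y u v :: 'a
      using norm_triangle_ineq4[of "x - u" "y - v"] norm_triangle_ineq[of "x - u - (y - v)" "u - v"]
      by simp
    note this[of "?S f D1" "?S f D2" "?S g D1" "?S g D2"]
    ultimately show "norm (?S f D1 - ?S f D2) < e" using e by linarith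
  qed
qed

text \<open>The level sets are measurable and bounded, so their indicators are integrable; the
  function is a finite sum of such indicators times its values.\<close>

lemma simple_function_integrable_on:
  fixes s :: "real \<Rightarrow> 'a::banach"
  assumes s: "simple_function (lebesgue_on {a..b}) s"
  shows "s integrable_on {a..b}"
proof -
  have meas: "s -` {y} \<inter> {a..b} \<in> sets (lebesgue_on {a..b})" if "y \<in> s ` {a..b}" for y
    using s that by (auto simp: simple_function_def)
  have fin: "finite (s ` {a..b})" using s by (auto simp: simple_function_def)
  have 1: "(\<lambda>x. indicat_real (s -` {y} \<inter> {a..b}) x *\<^sub>R y) integrable_on {a..b}" if "y \<in> s ` {a..b}" for y
  proof (intro integrable_on_scaleR_left)
    have "s -` {y} \<inter> {a..b} \<in> sets lebesgue"
      using meas[OF that] by (subst (asm) sets_restrict_space_iff) auto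
    then have "s -` {y} \<inter> {a..b} \<in> lmeasurable"
      by (intro bounded_set_imp_lmeasurable) (auto intro: bounded_subset[of "{a..b}"])
    then show "indicat_real (s -` {y} \<inter> {a..b}) integrable_on {a..b}"
      by (simp add: integrable_on_indicator Int_assoc)
  qed
  have "(\<lambda>x. \<Sum>y\<in>s ` {a..b}. indicat_real (s -` {y} \<inter> {a..b}) x *\<^sub>R y) integrable_on {a..b}"
    by (rule integrable_sum) (use fin 1 in auto)
  moreover have "(\<Sum>y\<in>s ` {a..b}. indicat_real (s -` {y} \<inter> {a..b}) x *\<^sub>R y) = s x" if "x \<in> {a..b}" for x
  proof -
    have "(\<Sum>y\<in>s ` {a..b}. indicat_real (s -` {y} \<inter> {a..b}) x *\<^sub>R y)
       = (\<Sum>y\<in>s ` {a..b}. if y = s x then y else 0)"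
      using that by (intro sum.cong) auto
    then show ?thesis using fin that by (simp add: sum.delta)
  qed
  ultimately show ?thesis by (rule integrable_eq)
qed

text \<open>Truncated simple functions approximate \<open>f\<close> in the L1 sense. Dominated
  convergence is applied only to the real functions \<open>norm (f0 x - r i x)\<close>, so no
  measure-theoretic integral of vector values occurs.\<close>

lemma strongly_measurable_integrable_on:
  fixes f :: "real \<Rightarrow> 'a::banach"
  assumes f: "strongly_measurable (lebesgue_on {a..b}) f"
    and nf: "(\<lambda>x. norm (f x)) integrable_on {a..b}"
  shows "f integrable_on {a..b}"
proof -
  let ?M = "lebesgue_on {a..b}"
  obtain s where s: "\<And>i::nat. simple_function ?M (s i)"
    and lim: "AE x in ?M. (\<lambda>i. s i x) \<longlonglongrightarrow> f x"
    using f unfolding strongly_measurable_def by auto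
  obtain N where N: "N \<in> null_sets ?M" "{x\<in>space ?M. \<not> (\<lambda>i. s i x) \<longlonglongrightarrow> f x} \<subseteq> N"
    using lim by (auto simp: eventually_ae_filter)
  have limN: "(\<lambda>i. s i x) \<longlonglongrightarrow> f x" if "x \<in> {a..b}" "x \<notin> N" for x
    using N(2) that by auto
  \<comment> \<open>Setting \<open>f\<close> and its approximations to zero on the null set
    \<open>N\<close> turns convergence almost everywhere into convergence at every point of the
    interval.\<close>
  define f0 where "f0 x = (if x \<in> N then 0 else f x)" for x
  define s0 where "s0 i x = (if x \<in> N then 0 else s i x)" for i x
  \<comment> \<open>truncated so that \<open>3 \<parallel>f0\<parallel>\<close> dominates \<open>\<parallel>f0 - r i\<parallel>\<close>\<close>
  define r where "r i x = (if norm (s0 i x) \<le> 2 * norm (f0 x) then s0 i x else 0)" for i x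
  have "(\<lambda>x. norm (f x)) absolutely_integrable_on {a..b}"
    using nf by (simp add: absolutely_integrable_on_iff_nonneg)
  then have nfi: "integrable ?M (\<lambda>x. norm (f x))"
    by (simp add: set_integrable_def integrable_restrict_space)
  have Nm[measurable]: "N \<in> sets ?M" using N(1) by auto
  have nf0: "integrable ?M (\<lambda>x. norm (f0 x))"
  proof -
    have [measurable]: "(\<lambda>x. norm (f x)) \<in> borel_measurable ?M" using nfi by auto
    have "(\<lambda>x. norm (f0 x)) = (\<lambda>x. if x \<in> N then 0 else norm (f x))" by (auto simp: f0_def)
    then have "(\<lambda>x. norm (f0 x)) \<in> borel_measurable ?M" by simp
    then show ?thesis by (rule Bochner_Integration.integrable_bound[OF nfi]) (auto simp: f0_def)
  qed
  then have nf0_meas: "(\<lambda>x. norm (f0 x)) \<in> borel_measurable ?M" by auto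
  have s0: "simple_function ?M (s0 i)" for i
    unfolding s0_def by (intro simple_function_If_set simple_function_const s) (use Nm in auto)
  have ns0_meas: "(\<lambda>x. norm (s0 i x)) \<in> borel_measurable ?M" for i
    by (rule borel_measurable_simple_function, rule simple_function_compose1[OF s0])
  have "{x \<in> space ?M. norm (s0 i x) \<le> 2 * norm (f0 x)} \<in> sets ?M" for i
    by (intro borel_measurable_le borel_measurable_times borel_measurable_const nf0_meas ns0_meas)
  then have r: "simple_function ?M (r i)" for i
    unfolding r_def by (intro simple_function_If s0 simple_function_const)
  have lim0: "(\<lambda>i. s0 i x) \<longlonglongrightarrow> f0 x" if "x \<in> {a..b}" for x
    using limN[OF that] by (auto simp: s0_def f0_def)
  have limr: "(\<lambda>i. r i x) \<longlonglongrightarrow> f0 x" if "x \<in> {a..b}" for x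
  proof (cases "f0 x = 0")
    case True
    then have "r i x = 0" for i by (auto simp: r_def)
    then show ?thesis using True by simp
  next
    case False
    have "(\<lambda>i. norm (s0 i x)) \<longlonglongrightarrow> norm (f0 x)" by (rule tendsto_norm[OF lim0[OF that]])
    then have "\<forall>\<^sub>F i in sequentially. norm (s0 i x) < 2 * norm (f0 x)"
      by (rule order_tendstoD) (use False in auto)
    then have "\<forall>\<^sub>F i in sequentially. s0 i x = r i x"
      by eventually_elim (auto simp: r_def)
    then show ?thesis using lim0[OF that] by (rule Lim_transform_eventually[rotated])
  qed
  \<comment> \<open>Measurability comes from the real functions
    \<open>norm (s0 j x - r i x)\<close>, which are simple and converge pointwise as
    \<open>j\<close> grows.\<close>
  have meas: "(\<lambda>x. norm (f0 x - r i x)) \<in> borel_measurable ?M" for i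
  proof (rule borel_measurable_LIMSEQ_real)
    show "(\<lambda>j. norm (s0 j x - r i x)) \<longlonglongrightarrow> norm (f0 x - r i x)" if "x \<in> space ?M" for x
      using lim0 that by (intro tendsto_intros) auto
    show "(\<lambda>x. norm (s0 j x - r i x)) \<in> borel_measurable ?M" for j
      by (rule borel_measurable_simple_function, rule simple_function_compose2[OF s0 r])
  qed
  have bound: "norm (f0 x - r i x) \<le> 3 * norm (f0 x)" for i x
    using norm_triangle_ineq4[of "f0 x" "r i x"] by (auto simp: r_def)
  have int: "integrable ?M (\<lambda>x. norm (f0 x - r i x))" for i
    by (rule Bochner_Integration.integrable_bound[where f = "\<lambda>x. 3 * norm (f0 x)"])
      (use nf0 meas bound in auto)
  have "(\<lambda>i. integral\<^sup>L ?M (\<lambda>x. norm (f0 x - r i x))) \<longlonglongrightarrow> integral\<^sup>L ?M (\<lambda>x. 0)"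
  proof (rule integral_dominated_convergence[where w = "\<lambda>x. 3 * norm (f0 x)"])
    show "AE x in ?M. (\<lambda>i. norm (f0 x - r i x)) \<longlonglongrightarrow> 0"
    proof (rule AE_I2)
      fix x assume "x \<in> space ?M"
      then have "(\<lambda>i. norm (f0 x - r i x)) \<longlonglongrightarrow> norm (f0 x - f0 x)"
        by (intro tendsto_intros limr) auto
      then show "(\<lambda>i. norm (f0 x - r i x)) \<longlonglongrightarrow> 0" by simp
    qed
  qed (use nf0 meas bound in auto)
  then have conv: "(\<lambda>i. integral {a..b} (\<lambda>x. norm (f0 x - r i x))) \<longlonglongrightarrow> 0"
    by (simp add: lebesgue_integral_eq_integral[OF int])
  have "f0 integrable_on cbox a b"
  proof (rule integrable_on_if_L1_approximable)
    fix e :: real assume "e > 0"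
    then have "\<forall>\<^sub>F i in sequentially. integral {a..b} (\<lambda>x. norm (f0 x - r i x)) < e"
      by (rule order_tendstoD(2)[OF conv])
    then obtain i where "integral {a..b} (\<lambda>x. norm (f0 x - r i x)) < e"
      by (auto simp: eventually_sequentially)
    moreover have "(\<lambda>x. norm (f0 x - r i x)) integrable_on {a..b}"
      by (rule integrable_on_lebesgue_on[OF int]) simp
    ultimately show "\<exists>g. g integrable_on cbox a b \<and> (\<lambda>x. norm (f0 x - g x)) integrable_on cbox a b \<and>
       integral (cbox a b) (\<lambda>x. norm (f0 x - g x)) < e"
      using simple_function_integrable_on[OF r] by auto
  qed
  moreover have "negligible N"
    using N(1) by (simp add: negligible_iff_null_sets null_sets_restrict_space)
  ultimately show ?thesis
    by (auto simp: f0_def intro: integrable_spike[where f = f0])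
qed

section \<open>Square integrable functions and their modulation by exponentials\<close>

lemma strongly_measurable_const: "strongly_measurable M (\<lambda>_. h)"
  unfolding strongly_measurable_def by (intro exI[of _ "\<lambda>_ _. h"]) auto

text \<open>The products of simple approximations of \<open>g\<close> and of \<open>f\<close> are
  simple and converge wherever those of \<open>f\<close> do.\<close>

lemma strongly_measurable_scaleC:
  fixes f :: "'b \<Rightarrow> 'h::complex_hilbert"
  assumes g: "g \<in> borel_measurable M" and f: "strongly_measurable M f"
  shows "strongly_measurable M (\<lambda>s. g s *\<^sub>C f s)"
proof -
  obtain s where s: "\<And>i::nat. simple_function M (s i)"
    and lims: "AE x in M. (\<lambda>i. s i x) \<longlonglongrightarrow> f x"
    using f unfolding strongly_measurable_def by auto
  obtain r where "(\<forall>i::nat. simple_function M (r i)) \<and> (\<forall>x\<in>space M. (\<lambda>i. r i x) \<longlonglongrightarrow> g x) \<and>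
      (\<forall>i. \<forall>x\<in>space M. dist (r i x) 0 \<le> 2 * dist (g x) 0)"
    using borel_measurable_implies_sequence_metric[OF g, of 0] by (rule exE)
  note r = this[THEN conjunct1, rule_format]
    and limr = this[THEN conjunct2, THEN conjunct1, rule_format]
  have "AE x in M. (\<lambda>i. r i x *\<^sub>C s i x) \<longlonglongrightarrow> g x *\<^sub>C f x"
    using lims AE_space[of M] by eventually_elim (rule scaleC.tendsto[OF limr])
  then show ?thesis
    unfolding strongly_measurable_def
    using simple_function_compose2[OF r s, of scaleC]
    by (intro exI[of _ "\<lambda>i x. r i x *\<^sub>C s i x"]) simp
qed

lemma cis_scaleC_in_L2_fun:
  assumes "f \<in> L2_fun \<omega>"
  shows "(\<lambda>s. cis (a * s) *\<^sub>C f s) \<in> L2_fun \<omega>"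
proof -
  have "(\<lambda>s. cis (a * s)) \<in> borel_measurable (lebesgue_on {0..\<omega>})"
    by (intro continuous_imp_measurable_on_sets_lebesgue continuous_intros) auto
  with assms show ?thesis
    by (simp add: L2_fun_def strongly_measurable_scaleC norm_scaleC)
qed

lemma const_in_L2_fun: "(\<lambda>_. h) \<in> L2_fun \<omega>"
  by (simp add: L2_fun_def strongly_measurable_const integrable_const_ivl)

text \<open>On a bounded interval the norm is dominated by one plus its square. The result makes the
  Fourier integral a genuine integral, through which bounded functionals can be moved.\<close>

lemma L2_fun_integrable_on:
  assumes "f \<in> L2_fun \<omega>"
  shows "f integrable_on {0..\<omega>}"
proof (rule strongly_measurable_integrable_on)
  show "strongly_measurable (lebesgue_on {0..\<omega>}) f" using assms by (simp add: L2_fun_def)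
  let ?M = "lebesgue_on {0..\<omega>}"
  \<comment> \<open>Nonnegativity turns gauge integrability of the squared norm into Lebesgue
    integrability, hence measurability; a square root then gives measurability of the norm
    itself.\<close>
  have sq: "(\<lambda>s. (norm (f s))\<^sup>2) absolutely_integrable_on {0..\<omega>}"
    using assms by (simp add: L2_fun_def absolutely_integrable_on_iff_nonneg)
  then have "integrable ?M (\<lambda>s. (norm (f s))\<^sup>2)"
    by (rule absolutely_integrable_imp_integrable) simp
  then have "(\<lambda>s. sqrt ((norm (f s))\<^sup>2)) \<in> borel_measurable ?M"
    by (rule measurable_compose[OF borel_measurable_integrable borel_measurable_sqrt])
  then have meas: "(\<lambda>s. norm (f s)) \<in> borel_measurable ?M" by simp
  have "norm (f s) \<le> 1 + (norm (f s))\<^sup>2" for s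
  proof -
    have "2 * norm (f s) \<le> 1 + (norm (f s))\<^sup>2"
      using zero_le_power2[of "norm (f s) - 1"] by (simp add: power2_diff)
    then show ?thesis using norm_ge_zero[of "f s"] by linarith
  qed
  moreover have "(\<lambda>s. 1 + (norm (f s))\<^sup>2) integrable_on {0..\<omega>}"
    using assms by (intro integrable_add) (auto simp: L2_fun_def)
  ultimately show "(\<lambda>s. norm (f s)) integrable_on {0..\<omega>}"
    by (intro measurable_bounded_by_integrable_imp_integrable[OF meas]) auto
qed

lemma integral_cis_period:
  fixes l :: int
  assumes "\<omega> > 0"
  shows "integral {0..\<omega>} (\<lambda>s. cis (2 * pi * of_int l * s / \<omega>)) = (if l = 0 then of_real \<omega> else 0)"
proof (cases "l = 0")
  case True
  then show ?thesis using assms by (simp add: scaleR_conv_of_real)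
next
  case False
  define a where "a = 2 * pi * of_int l / \<omega>"
  have a: "a \<noteq> 0" using False assms by (simp add: a_def)
  have "((\<lambda>s. cis (a * s)) has_integral (cis (a * \<omega>) / (\<i> * a) - cis (a * 0) / (\<i> * a))) {0..\<omega>}"
  proof (rule fundamental_theorem_of_calculus)
    fix s assume "s \<in> {0..\<omega>}"
    \<comment> \<open>The antiderivative is differentiated in the complex plane and then restricted
      to the real line.\<close>
    have "((\<lambda>z. exp (\<i> * a * z) / (\<i> * a)) has_field_derivative exp (\<i> * a * s)) (at (of_real s))"
      by (rule derivative_eq_intros refl)+ (use a in \<open>simp_all add: field_simps\<close>)
    from has_vector_derivative_real_field[OF this]
    have "((\<lambda>s. exp (\<i> * a * s) / (\<i> * a)) has_vector_derivative exp (\<i> * a * s)) (at s within {0..\<omega>})" .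
    then show "((\<lambda>s. cis (a * s) / (\<i> * a)) has_vector_derivative cis (a * s)) (at s within {0..\<omega>})"
      by (simp add: cis_conv_exp mult.assoc)
  qed (use assms in simp)
  moreover have "cis (a * \<omega>) = 1"
    using assms cis_multiple_2pi[of "of_int l"] by (simp add: a_def)
  ultimately have "integral {0..\<omega>} (\<lambda>s. cis (a * s)) = 0" by (simp add: integral_unique)
  then show ?thesis using False by (simp add: a_def)
qed

section \<open>Fourier coefficients and spectral projections\<close>

locale L2_space =
  fixes \<omega> :: real and Q :: "(real \<Rightarrow> 'h::complex_hilbert) \<Rightarrow> 'l::complex_hilbert"
  assumes \<omega>_pos: "\<omega> > 0" and quotient: "L2_quotient \<omega> Q"
begin

text \<open>For fixed \<open>l\<close> this is an isometric embedding of the coefficient space onto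
  the range of \<open>P l\<close>. Together with its adjoint it factors \<open>P l\<close>, so that
  later arguments need not choose representatives.\<close>

definition wave :: "int \<Rightarrow> 'h \<Rightarrow> 'l" where
  "wave l h = Q (\<lambda>s. cis (2 * pi * of_int l * s / \<omega>) *\<^sub>C h)"

abbreviation F :: "'l \<Rightarrow> int \<Rightarrow> 'h" where "F \<equiv> fourier \<omega> Q"
abbreviation P :: "int \<Rightarrow> 'l \<Rightarrow> 'l" where "P \<equiv> Proj \<omega> Q"

lemma wave_in_L2_fun: "(\<lambda>s. cis (2 * pi * of_int l * s / \<omega>) *\<^sub>C h) \<in> L2_fun \<omega>"
  using cis_scaleC_in_L2_fun[OF const_in_L2_fun, of "2 * pi * of_int l / \<omega>" h \<omega>] by simp

lemma Q_add: "f \<in> L2_fun \<omega> \<Longrightarrow> g \<in> L2_fun \<omega> \<Longrightarrow> Q (\<lambda>s. f s + g s) = Q f + Q g"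
  and Q_scaleC: "f \<in> L2_fun \<omega> \<Longrightarrow> Q (\<lambda>s. c *\<^sub>C f s) = c *\<^sub>C Q f"
  and cinner_Q: "f \<in> L2_fun \<omega> \<Longrightarrow> g \<in> L2_fun \<omega> \<Longrightarrow>
    cinner (Q f) (Q g) = (1 / \<omega>) *\<^sub>R integral {0..\<omega>} (\<lambda>s. cinner (f s) (g s))"
  using quotient unfolding L2_quotient_def by blast+

lemma wave_add: "wave l (g + h) = wave l g + wave l h"
  unfolding wave_def by (subst Q_add[symmetric]) (simp_all add: wave_in_L2_fun scaleC_add_right)

lemma wave_scaleC: "wave l (c *\<^sub>C h) = c *\<^sub>C wave l h"
  unfolding wave_def
  by (subst Q_scaleC[symmetric]) (simp_all add: wave_in_L2_fun scaleC_scaleC mult.commute[of c])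

text \<open>The Fourier coefficient is the adjoint of \<^const>\<open>wave\<close>; in particular it does not depend on
  the representative, and its linearity follows.\<close>

lemma cinner_wave: "cinner x (wave l h) = cinner (F x l) h"
proof -
  define f where "f = inv_into (L2_fun \<omega>) Q x"
  have "x \<in> Q ` L2_fun \<omega>" using quotient by (simp add: L2_quotient_def)
  then have f: "f \<in> L2_fun \<omega>" "Q f = x"
    by (simp_all add: f_def inv_into_into f_inv_into_f)
  let ?f = "\<lambda>s. cis (- (2 * pi * of_int l * s / \<omega>)) *\<^sub>C f s"
  have "?f \<in> L2_fun \<omega>"
    using cis_scaleC_in_L2_fun[OF f(1), of "- (2 * pi * of_int l / \<omega>)"] by simp
  then have int: "?f integrable_on {0..\<omega>}" by (rule L2_fun_integrable_on)
  \<comment> \<open>The exponential in the second slot moves to the first as its conjugate, which is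
    exactly the kernel of \<open>fourier_fun\<close>.\<close>
  have "cinner x (wave l h) = (1 / \<omega>) *\<^sub>R integral {0..\<omega>} (\<lambda>s. cinner (?f s) h)"
    unfolding wave_def f(2)[symmetric]
    by (simp add: cinner_Q f(1) wave_in_L2_fun cinner_scaleC_left cinner_scaleC_right cis_cnj)
  also have "integral {0..\<omega>} (\<lambda>s. cinner (?f s) h) = cinner (integral {0..\<omega>} ?f) h"
    using integral_linear[OF int cinner.bounded_linear_left[of h]] by (simp add: o_def)
  also have "(1 / \<omega>) *\<^sub>R \<dots> = cinner (F x l) h"
    by (simp add: fourier_def fourier_fun_def f_def cinner.scaleR_left)
  finally show ?thesis .
qed

lemma cinner_wave_wave: "cinner (wave j g) (wave l h) = (if j = l then cinner g h else 0)"
proof -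
  have "cinner (wave j g) (wave l h)
      = (1 / \<omega>) *\<^sub>R integral {0..\<omega>} (\<lambda>s. cis (2 * pi * of_int (j - l) * s / \<omega>) * cinner g h)"
  proof -
    have "cinner (cis a *\<^sub>C g) (cis b *\<^sub>C h) = cis (a - b) * cinner g h" for a b
      by (simp add: cinner_scaleC_left cinner_scaleC_right cis_cnj cis_mult mult.assoc[symmetric])
    moreover have "2 * pi * of_int j * s / \<omega> - 2 * pi * of_int l * s / \<omega> = 2 * pi * of_int (j - l) * s / \<omega>" for s
      by (simp add: diff_divide_distrib algebra_simps)
    ultimately show ?thesis
      by (simp only: wave_def cinner_Q wave_in_L2_fun)
  qed
  also have "\<dots> = (1 / \<omega>) *\<^sub>R ((if j - l = 0 then of_real \<omega> else 0) * cinner g h)"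
    by (simp only: integral_mult_left integral_cis_period[OF \<omega>_pos])
  also have "\<dots> = (if j = l then cinner g h else 0)"
    using \<omega>_pos by (simp add: scaleR_conv_of_real)
  finally show ?thesis .
qed

lemma norm_wave: "norm (wave l h) = norm h"
proof -
  have "complex_of_real ((norm (wave l h))\<^sup>2) = complex_of_real ((norm h)\<^sup>2)"
    by (simp only: cinner_self[symmetric] cinner_wave_wave if_True refl)
  then have "(norm (wave l h))\<^sup>2 = (norm h)\<^sup>2" by (simp only: of_real_eq_iff)
  then show ?thesis by (simp add: power2_eq_iff_nonneg)
qed

lemma fourier_add: "F (x + y) l = F x l + F y l"
  by (rule cinner_ext) (simp add: cinner_wave[symmetric] cinner_add_left)

lemma fourier_scaleC: "F (c *\<^sub>C x) l = c *\<^sub>C F x l"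
  by (rule cinner_ext) (simp add: cinner_wave[symmetric] cinner_scaleC_left)

lemma fourier_wave: "F (wave j h) l = (if j = l then h else 0)"
  by (rule cinner_ext) (simp add: cinner_wave[symmetric] cinner_wave_wave cinner.zero_left)

lemma wave_zero: "wave l 0 = 0"
  using norm_wave[of l 0] by simp

section \<open>The spectral projections as mutually orthogonal projections\<close>

lemma Proj_eq_wave: "P l x = wave l (F x l)"
  by (simp add: Proj_def wave_def)

lemma norm_Proj: "norm (P l x) = norm (F x l)"
  by (simp add: Proj_eq_wave norm_wave)

lemma Proj_add: "P l (x + y) = P l x + P l y"
  by (simp add: Proj_eq_wave fourier_add wave_add)

lemma Proj_scaleC: "P l (c *\<^sub>C x) = c *\<^sub>C P l x"
  by (simp add: Proj_eq_wave fourier_scaleC wave_scaleC)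

lemma Proj_Proj: "P l (P j x) = (if l = j then P l x else 0)"
  by (simp add: Proj_eq_wave fourier_wave wave_zero)

lemma cinner_Proj: "cinner x (P l y) = cinner (F x l) (F y l)"
  by (simp add: Proj_eq_wave cinner_wave)

lemma orthogonal_Proj: "l \<noteq> j \<Longrightarrow> orthogonal (P l x) (P j y)"
  by (simp add: orthogonal_def inner_eq_Re_cinner Proj_eq_wave cinner_wave_wave)

lemma inner_Proj: "inner x (P l x) = (norm (P l x))\<^sup>2"
  by (simp add: inner_eq_Re_cinner cinner_Proj cinner_self norm_Proj)

lemma norm_Proj_le: "norm (P l x) \<le> norm x"
proof (cases "P l x = 0")
  case False
  have "norm (P l x) * norm (P l x) \<le> norm x * norm (P l x)"
    using norm_cauchy_schwarz[of x "P l x"] by (simp add: inner_Proj power2_eq_square)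
  with False show ?thesis by simp
qed simp

lemma bounded_linear_Proj: "bounded_linear (P l)"
  by (rule bounded_linear_intro[of _ 1])
    (simp_all add: Proj_add Proj_scaleC scaleR_scaleC norm_Proj_le)

text \<open>Membership in a mode becomes a fixed point equation, so closure properties of the mode
  reduce to rewriting.\<close>

lemma range_Proj_iff: "x \<in> range (P l) \<longleftrightarrow> P l x = x"
proof
  show "P l x = x" if "x \<in> range (P l)" using that by (auto simp: Proj_Proj)
  show "x \<in> range (P l)" if "P l x = x" using rangeI[of "P l" x] that by simp
qed

lemma Bessel_inequality: "finite A \<Longrightarrow> (\<Sum>l\<in>A. (norm (P l x))\<^sup>2) \<le> (norm x)\<^sup>2"
proof -
  assume A: "finite A"
  let ?y = "\<Sum>l\<in>A. P l x"
  have y: "(norm ?y)\<^sup>2 = (\<Sum>l\<in>A. (norm (P l x))\<^sup>2)"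
    using A by (intro norm_sum_Pythagorean) (auto simp: pairwise_def orthogonal_Proj)
  have "inner x ?y = (\<Sum>l\<in>A. (norm (P l x))\<^sup>2)"
    by (simp add: inner_sum_right inner_Proj)
  moreover have "0 \<le> (norm (x - ?y))\<^sup>2" by simp
  ultimately show ?thesis
    using y by (simp add: power2_norm_eq_inner inner_diff_left inner_diff_right inner_commute)
qed

lemma summable_norm_Proj_square: "(\<lambda>l. (norm (P l x))\<^sup>2) summable_on A"
proof (rule nonneg_bdd_above_summable_on)
  show "bdd_above (sum (\<lambda>l. (norm (P l x))\<^sup>2) ` {F. F \<subseteq> A \<and> finite F})"
    by (rule bdd_aboveI[where M = "(norm x)\<^sup>2"]) (auto intro: Bessel_inequality)
qed simp

end

section \<open>Exponentials of bounded operators\<close>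

lemma ratio_le_onorm_on:
  assumes A: "bounded_clinear_on S A" and x: "x \<in> S"
  shows "norm (A x) / norm x \<le> onorm_on S A"
proof -
  obtain K where K: "\<And>y. y \<in> S \<Longrightarrow> norm (A y) \<le> K * norm y"
    using A unfolding bounded_clinear_on_def by blast
  have "bdd_above ((\<lambda>y. norm (A y) / norm y) ` S)"
  proof (rule bdd_aboveI2)
    \<comment> \<open>The maximum with \<open>0\<close> covers \<open>y = 0\<close>, where the
      quotient is \<open>0 / 0 = 0\<close> while \<open>K\<close> may be negative.\<close>
    show "norm (A y) / norm y \<le> max K 0" if "y \<in> S" for y
      using K[OF that] by (cases "y = 0") (auto simp: divide_le_eq le_max_iff_disj)
  qed
  then show ?thesis unfolding onorm_on_def by (rule cSUP_upper[OF x])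
qed

lemma onorm_on_bound:
  assumes A: "bounded_clinear_on S A" and x: "x \<in> S"
  shows "norm (A x) \<le> onorm_on S A * norm x"
proof (cases "x = 0")
  case True
  have "A (0 *\<^sub>C x) = 0 *\<^sub>C A x" using A x unfolding bounded_clinear_on_def by blast
  with True show ?thesis by (simp add: scaleC.zero_left)
next
  case False
  with ratio_le_onorm_on[OF A x] show ?thesis by (simp add: divide_le_eq)
qed

lemma onorm_on_nonneg: "bounded_clinear_on S A \<Longrightarrow> x \<in> S \<Longrightarrow> 0 \<le> onorm_on S A"
  by (rule order.trans[OF _ ratio_le_onorm_on]) auto

text \<open>Invariance of \<open>S\<close> lets the bound iterate to the powers of \<open>A\<close>,
  and \<open>g\<close> may be any bound. The facts are applied both to the multiple of a block by
  \<open>t\<close> and to that operator plus a scalar.\<close>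

context
  fixes S :: "'a::complex_hilbert set" and A :: "'a \<Rightarrow> 'a" and g :: real
  assumes maps: "\<And>x. x \<in> S \<Longrightarrow> A x \<in> S"
    and bound: "\<And>x. x \<in> S \<Longrightarrow> norm (A x) \<le> g * norm x" and g: "g \<ge> 0"
begin

lemma funpow_mem: "x \<in> S \<Longrightarrow> (A ^^ n) x \<in> S"
  by (induction n) (auto intro: maps)

lemma norm_funpow_le: "x \<in> S \<Longrightarrow> norm ((A ^^ n) x) \<le> g ^ n * norm x"
proof (induction n)
  case (Suc n)
  have "norm (A ((A ^^ n) x)) \<le> g * (g ^ n * norm x)"
    using bound[OF funpow_mem[OF Suc.prems]] Suc g by (meson mult_left_mono order_trans)
  then show ?case by (simp add: mult.assoc)
qed simp

lemma norm_op_exp_term_le: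
  "x \<in> S \<Longrightarrow> norm ((A ^^ n) x /\<^sub>R fact n) \<le> g ^ n /\<^sub>R fact n * norm x"
  using norm_funpow_le[of x n] by (simp add: divide_simps mult.commute)

lemma op_exp_bound_sums: "(\<lambda>n. g ^ n /\<^sub>R fact n * norm x) sums (exp g * norm x)"
  by (intro sums_mult2 exp_converges)

lemma summable_norm_op_exp: "x \<in> S \<Longrightarrow> summable (\<lambda>n. norm ((A ^^ n) x /\<^sub>R fact n))"
  by (rule summable_comparison_test[OF _ sums_summable[OF op_exp_bound_sums[of x]]])
    (use norm_op_exp_term_le[of x] in auto)

lemma summable_op_exp: "x \<in> S \<Longrightarrow> summable (\<lambda>n. (A ^^ n) x /\<^sub>R fact n)"
  by (rule summable_norm_cancel[OF summable_norm_op_exp])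

lemma norm_op_exp_le: "x \<in> S \<Longrightarrow> norm (op_exp A x) \<le> exp g * norm x"
  unfolding op_exp_def sums_unique[OF op_exp_bound_sums[of x]]
  by (rule norm_suminf_le[OF norm_op_exp_term_le sums_summable[OF op_exp_bound_sums]])

text \<open>Summing the binomial expansion of \<open>(c + A)\<^sup>n\<close> is a Cauchy product of a scalar series with a
  vector series; testing against each \<open>z\<close> reduces it to the scalar Cauchy product.\<close>

lemma op_exp_shift:
  assumes add: "\<And>x y. x \<in> S \<Longrightarrow> y \<in> S \<Longrightarrow> x + y \<in> S"
    and scale: "\<And>c x. x \<in> S \<Longrightarrow> c *\<^sub>C x \<in> S"
    and A_add: "\<And>x y. x \<in> S \<Longrightarrow> y \<in> S \<Longrightarrow> A (x + y) = A x + A y"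
    and A_scale: "\<And>c x. x \<in> S \<Longrightarrow> A (c *\<^sub>C x) = c *\<^sub>C A x"
    and x: "x \<in> S"
    and M_summable: "summable (\<lambda>n. ((\<lambda>y. c *\<^sub>C y + A y) ^^ n) x /\<^sub>R fact n)"
  shows "op_exp (\<lambda>y. c *\<^sub>C y + A y) x = exp c *\<^sub>C op_exp A x"
proof -
  define a where "a n = c ^ n /\<^sub>R fact n" for n
  define b where "b n = (A ^^ n) x /\<^sub>R fact n" for n
  \<comment> \<open>This is the Cauchy product of the scalar exponential series with that of
    \<open>A\<close>; it will turn out to be the series of \<open>?M\<close> term by term.\<close>
  define e where "e n = (\<Sum>i\<le>n. a i *\<^sub>C b (n - i))" for n
  let ?M = "\<lambda>y. c *\<^sub>C y + A y"
  have bS: "b n \<in> S" for n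
    unfolding b_def scaleR_scaleC by (intro scale funpow_mem x)
  have zS: "0 \<in> S" using scale[OF x, of 0] by (simp add: scaleC.zero_left)
  have A0: "A 0 = 0" using A_scale[OF x, of 0] by (simp add: scaleC.zero_left)
  have a_Suc: "c * a n = of_nat (Suc n) * a (Suc n)" for n
    by (simp add: a_def scaleR_conv_of_real field_simps del: of_nat_Suc)
  have b_Suc: "A (b n) = of_nat (Suc n) *\<^sub>C b (Suc n)" for n
  proof -
    have "A (b n) = complex_of_real (inverse (fact n)) *\<^sub>C (A ^^ Suc n) x"
      unfolding b_def scaleR_scaleC by (simp add: A_scale funpow_mem x)
    also have "complex_of_real (inverse (fact n)) = of_nat (Suc n) * complex_of_real (inverse (fact (Suc n)))"
      by (simp add: field_simps del: of_nat_Suc)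
    also have "\<dots> *\<^sub>C (A ^^ Suc n) x = of_nat (Suc n) *\<^sub>C b (Suc n)"
      by (simp only: b_def scaleR_scaleC scaleC_scaleC)
    finally show ?thesis .
  qed
  have A_sum: "A (sum f I) = (\<Sum>i\<in>I. A (f i)) \<and> sum f I \<in> S"
    if "finite I" "\<And>i. i \<in> I \<Longrightarrow> f i \<in> S" for f and I :: "nat set"
    using that by (induction I rule: finite_induct) (auto simp: A0 zS A_add add)
  \<comment> \<open>This is the recursion satisfied by \<open>(?M ^^ n) x /\<^sub>R fact n\<close>.
    The scalar contributes the factor \<open>i\<close> and \<open>A\<close> the factor
    \<open>Suc n - i\<close>, which add up to \<open>Suc n\<close>; each of the two sums is extended
    by one term whose factor is zero.\<close>
  have M_e: "?M (e n) = of_nat (Suc n) *\<^sub>C e (Suc n)" for n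
  proof -
    have "c *\<^sub>C e n = (\<Sum>i\<le>n. (of_nat (Suc i) * a (Suc i)) *\<^sub>C b (n - i))"
      by (simp only: e_def scaleC.sum_right scaleC_scaleC a_Suc)
    also have "\<dots> = (\<Sum>i\<le>Suc n. (of_nat i * a i) *\<^sub>C b (Suc n - i))"
      by (subst sum.atMost_Suc_shift) (simp add: scaleC.zero_left)
    finally have 1: "c *\<^sub>C e n = (\<Sum>i\<le>Suc n. (of_nat i * a i) *\<^sub>C b (Suc n - i))" .
    have "A (e n) = (\<Sum>i\<le>n. a i *\<^sub>C A (b (n - i)))"
      unfolding e_def by (simp add: A_sum A_scale scale bS)
    also have "\<dots> = (\<Sum>i\<le>n. (of_nat (Suc n - i) * a i) *\<^sub>C b (Suc n - i))"
      by (intro sum.cong refl)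
        (simp only: b_Suc scaleC_scaleC mult.commute atMost_iff Suc_diff_le)
    also have "\<dots> = (\<Sum>i\<le>Suc n. (of_nat (Suc n - i) * a i) *\<^sub>C b (Suc n - i))"
      by (simp add: scaleC.zero_left)
    finally have 2: "A (e n) = (\<Sum>i\<le>Suc n. (of_nat (Suc n - i) * a i) *\<^sub>C b (Suc n - i))" .
    have "(of_nat i * a i) *\<^sub>C v + (of_nat (Suc n - i) * a i) *\<^sub>C v
        = of_nat (Suc n) *\<^sub>C a i *\<^sub>C v" if "i \<le> Suc n" for i v
      using that
      by (simp only: scaleC_add_left[symmetric] distrib_right[symmetric] of_nat_add[symmetric]
        scaleC_scaleC le_add_diff_inverse)
    then show ?thesis
      unfolding 1 2 sum.distrib[symmetric] unfolding e_def scaleC.sum_right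
      by (intro sum.cong refl) simp_all
  qed
  have M_pow: "(?M ^^ n) x /\<^sub>R fact n = e n" for n
  proof (induction n)
    case 0
    then show ?case by (simp add: e_def a_def b_def scaleC_one)
  next
    case (Suc n)
    have eS: "e n \<in> S" unfolding e_def using A_sum[of "{..n}"] by (simp add: scale bS)
    have M_scale: "?M (r *\<^sub>R y) = r *\<^sub>R ?M y" if "y \<in> S" for r y
      using that by (simp add: scaleR_scaleC A_scale scaleC_add_right scaleC_scaleC mult.commute)
    have "(?M ^^ n) x = fact n *\<^sub>R e n" using Suc by (simp add: Suc[symmetric])
    then have "(?M ^^ Suc n) x = fact n *\<^sub>R ?M (e n)" using M_scale[OF eS] by simp
    also have "\<dots> = (fact n * real (Suc n)) *\<^sub>R e (Suc n)"
      by (simp only: M_e scaleR_scaleC scaleC_scaleC of_real_mult of_real_of_nat_eq)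
    also have "fact n * real (Suc n) = fact (Suc n)" by simp
    finally have "(?M ^^ Suc n) x = fact (Suc n) *\<^sub>R e (Suc n)" .
    then show ?case by (simp del: funpow.simps fact_Suc)
  qed
  show ?thesis
  proof (rule cinner_ext)
    fix z
    have sa: "summable (\<lambda>n. norm (a n))"
      unfolding a_def by (rule summable_norm_exp)
    have sb: "summable (\<lambda>n. norm (cinner (b n) z))"
    proof (rule summable_comparison_test)
      show "summable (\<lambda>n. norm (b n) * norm z)"
        unfolding b_def by (intro summable_mult2 summable_norm_op_exp x)
    qed (simp add: cmod_cinner_le)
    have e_sum: "cinner (e n) z = (\<Sum>i\<le>n. a i * cinner (b (n - i)) z)" for n
      by (simp add: e_def cinner.sum_left cinner_scaleC_left)
    \<comment> \<open>\<open>M_summable\<close> enters here: it allows the inner product to be taken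
      inside the series of \<open>?M\<close>.\<close>
    have "cinner (op_exp ?M x) z = (\<Sum>n. cinner (e n) z)"
      using bounded_linear.suminf[OF cinner.bounded_linear_left M_summable, of z]
      by (simp add: op_exp_def M_pow)
    also have "\<dots> = (\<Sum>n. a n) * (\<Sum>n. cinner (b n) z)"
      unfolding e_sum by (rule Cauchy_product[symmetric, OF sa sb])
    also have "(\<Sum>n. a n) = exp c" by (simp add: a_def exp_def)
    also have "(\<Sum>n. cinner (b n) z) = cinner (op_exp A x) z"
      using bounded_linear.suminf[OF cinner.bounded_linear_left summable_op_exp[OF x], of z]
      by (simp add: op_exp_def b_def)
    also have "exp c * \<dots> = cinner (exp c *\<^sub>C op_exp A x) z" by (simp add: cinner_scaleC_left)
    finally show "cinner (op_exp ?M x) z = cinner (exp c *\<^sub>C op_exp A x) z" .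
  qed
qed

end

section \<open>The block diagonal group\<close>

context L2_space
begin

lemma mode_exp_Proj:
  assumes B: "bounded_clinear_on (range (P l)) (B l)"
  shows norm_mode_exp_le: "norm (mode_exp \<omega> B t l (P l x))
      \<le> exp (onorm_on (range (P l)) (B l) * \<bar>t\<bar>) * norm (P l x)"
    and Proj_mode_exp: "P l (mode_exp \<omega> B t l (P l x)) = mode_exp \<omega> B t l (P l x)"
proof -
  let ?S = "range (P l)" and ?\<gamma> = "onorm_on (range (P l)) (B l)"
  define c where "c = Complex 0 (t * (2 * pi * of_int l / \<omega>))"
  define A where "A y = t *\<^sub>R B l y" for y
  let ?M = "\<lambda>y. c *\<^sub>C y + A y"
  have mode: "mode_exp \<omega> B t l = op_exp ?M"
    unfolding mode_exp_def
    by (rule arg_cong[where f = op_exp])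
      (simp add: fun_eq_iff c_def A_def scaleR_scaleC scaleC_add_right scaleC_scaleC complex_of_real_mult_Complex)
  have add: "y + z \<in> ?S" if "y \<in> ?S" "z \<in> ?S" for y z
    using that by (simp add: range_Proj_iff Proj_add)
  have scale: "d *\<^sub>C y \<in> ?S" if "y \<in> ?S" for d y
    using that by (simp add: range_Proj_iff Proj_scaleC)
  have B_maps: "B l y \<in> ?S"
    and B_add: "z \<in> ?S \<Longrightarrow> B l (y + z) = B l y + B l z"
    and B_scale: "B l (d *\<^sub>C y) = d *\<^sub>C B l y" if "y \<in> ?S" for y z d
    using B that unfolding bounded_clinear_on_def by blast+
  have A_maps: "A y \<in> ?S" if "y \<in> ?S" for y
    unfolding A_def scaleR_scaleC by (intro scale B_maps that)
  have A_bound: "norm (A y) \<le> (?\<gamma> * \<bar>t\<bar>) * norm y" if "y \<in> ?S" for y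
    using mult_left_mono[OF onorm_on_bound[OF B that], of "\<bar>t\<bar>"] by (simp add: A_def mult_ac)
  have A_add: "A (y + z) = A y + A z" if "y \<in> ?S" "z \<in> ?S" for y z
    using that by (simp add: A_def B_add scaleR_add_right)
  have A_scale: "A (d *\<^sub>C y) = d *\<^sub>C A y" if "y \<in> ?S" for d y
    using that by (simp add: A_def B_scale scaleR_scaleC scaleC_scaleC mult.commute)
  have g: "0 \<le> ?\<gamma> * \<bar>t\<bar>" using onorm_on_nonneg[OF B rangeI[of _ x]] by simp
  have M_maps: "?M y \<in> ?S" if "y \<in> ?S" for y
    by (intro add scale A_maps that)
  \<comment> \<open>This crude bound contains \<open>cmod c\<close> and serves the convergence of
    the series of \<open>?M\<close>. The sharp estimate comes from \<open>eq\<close>, where the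
    factor \<open>exp c\<close> with purely imaginary \<open>c\<close> has modulus one.\<close>
  have M_bound: "norm (?M y) \<le> (cmod c + ?\<gamma> * \<bar>t\<bar>) * norm y" if "y \<in> ?S" for y
    using norm_triangle_ineq[of "c *\<^sub>C y" "A y"] A_bound[OF that]
    by (simp add: norm_scaleC distrib_right)
  have M_g: "0 \<le> cmod c + ?\<gamma> * \<bar>t\<bar>" using g by simp
  note M_summable = summable_op_exp[of ?S ?M, OF M_maps M_bound M_g rangeI]
  have eq: "op_exp ?M (P l x) = exp c *\<^sub>C op_exp A (P l x)"
    by (rule op_exp_shift[of ?S A, OF A_maps A_bound g add scale A_add A_scale rangeI M_summable])
  have "cmod (exp c) = 1" by (simp add: c_def)
  then show "norm (mode_exp \<omega> B t l (P l x)) \<le> exp (?\<gamma> * \<bar>t\<bar>) * norm (P l x)"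
    using norm_op_exp_le[of ?S A, OF A_maps A_bound g rangeI] by (simp add: mode eq norm_scaleC)
  \<comment> \<open>All terms of the series lie in the range of \<open>P l\<close>, and the bounded
    operator \<open>P l\<close> may be applied term by term.\<close>
  have "P l ((?M ^^ n) (P l x) /\<^sub>R fact n) = (?M ^^ n) (P l x) /\<^sub>R fact n" for n
    unfolding range_Proj_iff[symmetric] scaleR_scaleC
    by (intro scale funpow_mem[of ?S ?M, OF M_maps M_bound M_g] rangeI)
  then show "P l (mode_exp \<omega> B t l (P l x)) = mode_exp \<omega> B t l (P l x)"
    unfolding mode op_exp_def
    by (simp add: bounded_linear.suminf[OF bounded_linear_Proj M_summable])
qed

text \<open>The uniform bound \<open>G\<close> replaces all the exponential weights by one constant,
  and Bessel's inequality then gives a summable majorant. The set \<open>A\<close> is left open so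
  that half lines, the finite middle range and the tail are all covered.\<close>

lemma mode_exp_tail:
  fixes B :: "int \<Rightarrow> 'l \<Rightarrow> 'l" and t :: real and x :: 'l
  assumes B: "\<And>l. l \<in> A \<Longrightarrow> bounded_clinear_on (range (P l)) (B l)"
    and G: "\<And>l. l \<in> A \<Longrightarrow> onorm_on (range (P l)) (B l) \<le> G"
  defines "v \<equiv> \<lambda>l. mode_exp \<omega> B t l (P l x)"
  shows summable_mode_exp: "v summable_on A"
    and norm_infsum_mode_exp_le: "(norm (infsum v A))\<^sup>2
      \<le> (\<Sum>\<^sub>\<infinity>l\<in>A. exp (2 * onorm_on (range (P l)) (B l) * \<bar>t\<bar>) * (norm (F x l))\<^sup>2)"
proof -
  let ?\<gamma> = "\<lambda>l. onorm_on (range (P l)) (B l)"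
  let ?h = "\<lambda>l. exp (2 * ?\<gamma> l * \<bar>t\<bar>) * (norm (F x l))\<^sup>2"
  have le: "(norm (v l))\<^sup>2 \<le> ?h l" if "l \<in> A" for l
  proof -
    have "(norm (v l))\<^sup>2 \<le> (exp (?\<gamma> l * \<bar>t\<bar>) * norm (P l x))\<^sup>2"
      unfolding v_def by (intro power_mono norm_mode_exp_le B that norm_ge_zero)
    also have "\<dots> = ?h l"
      by (simp add: power_mult_distrib norm_Proj exp_double[symmetric] mult.assoc)
    finally show ?thesis .
  qed
  have h: "?h summable_on A"
  proof (rule summable_on_comparison_test)
    show "(\<lambda>l. exp (2 * G * \<bar>t\<bar>) * (norm (P l x))\<^sup>2) summable_on A"
      by (intro summable_on_cmult_right summable_norm_Proj_square)
    show "?h l \<le> exp (2 * G * \<bar>t\<bar>) * (norm (P l x))\<^sup>2" if "l \<in> A" for l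
      using G[OF that] by (auto simp: norm_Proj intro!: mult_right_mono)
  qed simp
  have sq: "(\<lambda>l. (norm (v l))\<^sup>2) summable_on A"
    by (rule summable_on_comparison_test[OF h le]) auto
  have "v l = P l (v l)" if "l \<in> A" for l
    unfolding v_def by (rule Proj_mode_exp[symmetric]) (rule B[OF that])
  then have orth: "pairwise (\<lambda>i j. orthogonal (v i) (v j)) A"
    unfolding pairwise_def using orthogonal_Proj by metis
  show "v summable_on A" by (rule orthogonal_summable_on(1)[OF orth sq])
  show "(norm (infsum v A))\<^sup>2 \<le> infsum ?h A"
    unfolding orthogonal_summable_on(2)[OF orth sq] by (rule infsum_mono[OF sq h le])
qed

text \<open>Since \<open>P j\<close> kills the range of \<open>P l\<close> for
  \<open>j \<noteq> l\<close>, composing with \<open>P l\<close> keeps only row \<open>l\<close> of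
  the matrix of block norms. The squares here are thus the row sums of a convergent double series.
  This gives the square summability of \<open>\<beta>\<close>.\<close>

lemma summable_S2_norm_Proj:
  assumes W: "W \<in> S2 \<omega> Q"
  shows "(\<lambda>l. (S2_norm \<omega> Q (P l \<circ> W))\<^sup>2) summable_on A"
proof -
  let ?f = "\<lambda>(j, i). (onorm (P j \<circ> W \<circ> P i))\<^sup>2"
  have f: "?f summable_on Sigma UNIV (\<lambda>_. UNIV)" using W by (simp add: S2_def)
  have row: "(\<lambda>i. ?f (l, i)) summable_on UNIV" for l
    using summable_on_SigmaD1[OF f, of l] by simp
  have "(S2_norm \<omega> Q (P l \<circ> W))\<^sup>2 = (\<Sum>\<^sub>\<infinity>i. ?f (l, i))" for l
  proof -
    let ?g = "\<lambda>(j, i). (onorm (P j \<circ> (P l \<circ> W) \<circ> P i))\<^sup>2"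
    have "(S2_norm \<omega> Q (P l \<circ> W))\<^sup>2 = infsum ?g UNIV"
      unfolding S2_norm_def by (intro real_sqrt_pow2 infsum_nonneg) auto
    also have "\<dots> = infsum ?f (Pair l ` UNIV)"
    proof (rule infsum_cong_neutral)
      show "?g p = 0" if p: "p \<in> UNIV - Pair l ` UNIV" for p
      proof -
        obtain j i where ji: "p = (j, i)" "j \<noteq> l" using p by (cases p) auto
        then have "P j \<circ> (P l \<circ> W) \<circ> P i = (\<lambda>_. 0)" by (simp add: fun_eq_iff Proj_Proj)
        then show ?thesis using ji(1) by (simp add: onorm_zero)
      qed
      show "?g p = ?f p" if p: "p \<in> UNIV \<inter> Pair l ` UNIV" for p
      proof -
        obtain i where "p = (l, i)" using p by auto
        moreover have "P l \<circ> (P l \<circ> W) \<circ> P i = P l \<circ> W \<circ> P i" by (simp add: fun_eq_iff Proj_Proj)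
        ultimately show ?thesis by simp
      qed
    qed auto
    also have "\<dots> = (\<Sum>\<^sub>\<infinity>i. ?f (l, i))"
      by (subst infsum_reindex) (auto simp: o_def inj_on_def)
    finally show ?thesis .
  qed
  then have "(\<lambda>l. (S2_norm \<omega> Q (P l \<circ> W))\<^sup>2) summable_on UNIV"
    using summable_on_SigmaD[OF f row] by (simp only: prod.case)
  then show ?thesis by (rule summable_on_subset_banach) simp
qed

end

section \<open>The tail estimate for the transformed group\<close>

theorem theorem2p12:
  fixes \<omega> :: real
    and Q :: "(real \<Rightarrow> 'h::complex_hilbert) \<Rightarrow> 'l::complex_hilbert"
    and \<V> :: "real \<Rightarrow> 'h \<Rightarrow> 'h"
    and T :: "real \<Rightarrow> 'l \<Rightarrow> 'l"
    and k :: nat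
    and U W Bk :: "'l \<Rightarrow> 'l"
    and B :: "int \<Rightarrow> 'l \<Rightarrow> 'l"
    and \<beta> \<gamma> :: "int \<Rightarrow> real"
    and \<kappa> :: "nat \<Rightarrow> real"
  assumes "\<omega> > 0"
    and "L2_quotient \<omega> Q"
    and "admissible_potential \<omega> \<V>"
    and "C0_group T"
    and "generator_graph T = L_graph \<omega> Q \<V>"
    and "W \<in> S2 \<omega> Q"
    and "U = (\<lambda>x. x + W x)"
    and "continuously_invertible U"
    and "bounded_clinear_on (range (Proj_upto \<omega> Q k)) Bk"
    and "\<And>l. \<bar>l\<bar> > int k \<Longrightarrow> bounded_clinear_on (range (Proj \<omega> Q l)) (B l)"
    and "(\<lambda>l. (onorm_on (range (Proj \<omega> Q l)) (B l))\<^sup>2) summable_on {l. \<bar>l\<bar> > int k}"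
    and "\<And>t. inv U \<circ> T t \<circ> U = block_group \<omega> Q k Bk B t"
    and "\<And>l. \<bar>l\<bar> \<ge> int k + 1 \<Longrightarrow> \<beta> l = S2_norm \<omega> Q (Proj \<omega> Q l \<circ> W)"
    and "\<And>l. \<bar>l\<bar> \<ge> int k + 1 \<Longrightarrow> \<gamma> l = onorm_on (range (Proj \<omega> Q l)) (B l)"
    and "\<And>l. l \<ge> k + 1 \<Longrightarrow>
           \<kappa> l = (SUP n\<in>{n. \<bar>n\<bar> \<ge> int l}. onorm_on (range (Proj \<omega> Q n)) (B n))"
  shows "\<forall>\<psi>::'l. \<exists>C>0. \<forall>n>k. \<forall>t::real.
      norm (T t (U \<psi>) - U (op_exp (\<lambda>y. t *\<^sub>R Bk y) (Proj_upto \<omega> Q k \<psi>))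
            - (\<Sum>l\<in>{l. int k < \<bar>l\<bar> \<and> \<bar>l\<bar> \<le> int n}. U (mode_exp \<omega> B t l (Proj \<omega> Q l \<psi>))))
      \<le> C * sqrt (\<Sum>\<^sub>\<infinity>l\<in>{l. \<bar>l\<bar> \<ge> int n + 1}.
              exp (2 * \<gamma> l * \<bar>t\<bar>) * ((norm (fourier \<omega> Q \<psi> l))\<^sup>2 + (\<beta> l)\<^sup>2 * (norm \<psi>)\<^sup>2)) \<and>
      C * sqrt (\<Sum>\<^sub>\<infinity>l\<in>{l. \<bar>l\<bar> \<ge> int n + 1}.
              exp (2 * \<gamma> l * \<bar>t\<bar>) * ((norm (fourier \<omega> Q \<psi> l))\<^sup>2 + (\<beta> l)\<^sup>2 * (norm \<psi>)\<^sup>2))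
      \<le> C * exp (\<kappa> (n + 1) * \<bar>t\<bar>) * sqrt (\<Sum>\<^sub>\<infinity>l\<in>{l. \<bar>l\<bar> \<ge> int n + 1}.
              (norm (fourier \<omega> Q \<psi> l))\<^sup>2 + (\<beta> l)\<^sup>2 * (norm \<psi>)\<^sup>2)"
proof -
  interpret L2_space \<omega> Q by (rule L2_space.intro) fact+
  note W = assms(6) and U_inv = assms(8) and B = assms(10) and sq = assms(11) and T_U = assms(12)
    and \<beta> = assms(13) and \<gamma> = assms(14) and \<kappa> = assms(15)
  let ?\<gamma> = "\<lambda>l. onorm_on (range (P l)) (B l)"
  \<comment> \<open>One term of a convergent series of squares is at most the whole sum, so
    \<open>G\<close> bounds all blocks beyond \<open>k\<close> uniformly.\<close>
  define G where "G = sqrt (\<Sum>\<^sub>\<infinity>l\<in>{l. \<bar>l\<bar> > int k}. (?\<gamma> l)\<^sup>2)"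
  have G: "?\<gamma> l \<le> G" if "\<bar>l\<bar> > int k" for l
    unfolding G_def using finite_sum_le_infsum[OF sq, of "{l}"] that by (intro real_le_rsqrt) simp
  have U: "bounded_linear U" and "bij U"
    using U_inv bounded_clinear_on_UNIV_imp_bounded_linear
    by (auto simp: continuously_invertible_def)
  interpret U: bounded_linear U by (rule U)
  show ?thesis
  \<comment> \<open>Adding \<open>1\<close> keeps the constant positive even on the zero space,
    where \<open>onorm U = 0\<close>. The constant depends on \<open>U\<close> alone.\<close>
  proof (intro allI exI[of _ "onorm U + 1"] conjI impI)
    show "0 < onorm U + 1" using onorm_pos_le[OF U] by simp
    fix \<psi> :: 'l and n :: nat and t :: real
    assume n: "k < n"
    define D R where "D = {l. int k < \<bar>l\<bar> \<and> \<bar>l\<bar> \<le> int n}" and "R = {l. \<bar>l\<bar> \<ge> int n + 1}"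
    define v where "v l = mode_exp \<omega> B t l (P l \<psi>)" for l
    define q where "q l = (norm (F \<psi> l))\<^sup>2 + (\<beta> l)\<^sup>2 * (norm \<psi>)\<^sup>2" for l
    let ?h = "\<lambda>l. exp (2 * \<gamma> l * \<bar>t\<bar>) * q l"
    have v_summable: "v summable_on A" if "A \<subseteq> {l. \<bar>l\<bar> > int k}" for A
      unfolding v_def by (rule summable_mode_exp[where G = G]) (use that in \<open>auto intro: B G\<close>)
    have R_sub: "R \<subseteq> {l. \<bar>l\<bar> > int k}" using n by (auto simp: R_def)
    have finD: "finite D" by (rule finite_subset[of _ "{- int n..int n}"]) (auto simp: D_def)

    \<comment> \<open>The two half lines of the block group are regrouped into the finitely many
      modes \<open>D\<close> that the theorem subtracts and the remaining tail
      \<open>R\<close>.\<close>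
    have "infsum v {..- int k - 1} + infsum v {int k + 1..} = infsum v ({..- int k - 1} \<union> {int k + 1..})"
      by (rule infsum_Un_disjoint[symmetric]) (auto intro!: v_summable)
    also have "{..- int k - 1} \<union> {int k + 1..} = D \<union> R" using n by (auto simp: D_def R_def)
    also have "infsum v (D \<union> R) = sum v D + infsum v R"
      using finD by (subst infsum_Un_disjoint) (use n in \<open>auto intro!: v_summable simp: D_def R_def\<close>)
    finally have split: "infsum v {..- int k - 1} + infsum v {int k + 1..} = sum v D + infsum v R" .
    have "T t (U \<psi>) = U (inv U (T t (U \<psi>)))"
      using \<open>bij U\<close> by (simp add: bij_is_surj surj_f_inv_f)
    also have "inv U (T t (U \<psi>)) = block_group \<omega> Q k Bk B t \<psi>"
      using fun_cong[OF T_U, of t \<psi>] by simp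
    also have "\<dots> = op_exp (\<lambda>y. t *\<^sub>R Bk y) (Proj_upto \<omega> Q k \<psi>) + sum v D + infsum v R"
      using split unfolding block_group_def v_def[symmetric] by (simp add: algebra_simps)
    finally have diff: "T t (U \<psi>) - U (op_exp (\<lambda>y. t *\<^sub>R Bk y) (Proj_upto \<omega> Q k \<psi>)) - (\<Sum>l\<in>D. U (v l))
        = U (infsum v R)"
      by (simp add: U.add U.sum)

    have R_\<gamma>: "\<gamma> l = ?\<gamma> l" and \<gamma>_\<kappa>: "\<gamma> l \<le> \<kappa> (n + 1)" if "l \<in> R" for l
    proof -
      show eq: "\<gamma> l = ?\<gamma> l" using that n by (intro \<gamma>) (simp add: R_def)
      \<comment> \<open>The supremum defining \<open>\<kappa> (n + 1)\<close> runs exactly over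
        \<open>R\<close>. Boundedness by \<open>G\<close> ensures that it really dominates each of
        its members.\<close>
      have "bdd_above (?\<gamma> ` {j. \<bar>j\<bar> \<ge> int (n + 1)})"
        using n by (intro bdd_aboveI2[where M = G] G) auto
      then show "\<gamma> l \<le> \<kappa> (n + 1)"
        unfolding eq using n that by (subst \<kappa>) (auto intro!: cSUP_upper simp: R_def)
    qed
    have "(\<lambda>l. (\<beta> l)\<^sup>2) summable_on R"
      using summable_S2_norm_Proj[OF W, of R] n
      by (subst summable_on_cong[of R _ "\<lambda>l. (S2_norm \<omega> Q (P l \<circ> W))\<^sup>2"]) (auto simp: R_def \<beta>)
    then have q: "q summable_on R"
      unfolding q_def using summable_norm_Proj_square[of \<psi> R]
      by (intro summable_on_add summable_on_cmult_left) (simp_all add: norm_Proj)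
    have q_nonneg: "0 \<le> q l" for l by (simp add: q_def)
    \<comment> \<open>The weight is written as a square so that the final square root releases a
      single factor \<open>exp (\<kappa> (n + 1) * \<bar>t\<bar>)\<close>.\<close>
    have h_le: "?h l \<le> (exp (\<kappa> (n + 1) * \<bar>t\<bar>))\<^sup>2 * q l" if "l \<in> R" for l
      using \<gamma>_\<kappa>[OF that] q_nonneg[of l]
      by (auto simp: exp_double[symmetric] mult.assoc intro!: mult_right_mono)
    have h: "?h summable_on R"
      by (rule summable_on_comparison_test[OF summable_on_cmult_right[OF q] h_le])
        (auto simp: q_nonneg)

    have "(norm (infsum v R))\<^sup>2 \<le> (\<Sum>\<^sub>\<infinity>l\<in>R. exp (2 * ?\<gamma> l * \<bar>t\<bar>) * (norm (F \<psi> l))\<^sup>2)"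
      unfolding v_def by (rule norm_infsum_mode_exp_le[where G = G]) (use R_sub in \<open>auto intro: B G\<close>)
    also have "\<dots> \<le> infsum ?h R"
    proof (rule infsum_mono[OF _ h])
      show le: "exp (2 * ?\<gamma> l * \<bar>t\<bar>) * (norm (F \<psi> l))\<^sup>2 \<le> ?h l" if "l \<in> R" for l
        using that by (simp add: R_\<gamma> q_def)
      show "(\<lambda>l. exp (2 * ?\<gamma> l * \<bar>t\<bar>) * (norm (F \<psi> l))\<^sup>2) summable_on R"
        by (rule summable_on_comparison_test[OF h le]) auto
    qed
    finally have "norm (infsum v R) \<le> sqrt (infsum ?h R)" by (rule real_le_rsqrt)
    then have "norm (U (infsum v R)) \<le> (onorm U + 1) * sqrt (infsum ?h R)"
      using onorm[OF U, of "infsum v R"] onorm_pos_le[OF U]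
      by (meson mult_mono norm_ge_zero order_trans le_add_same_cancel1 zero_le_one add_nonneg_nonneg)
    then show "norm (T t (U \<psi>) - U (op_exp (\<lambda>y. t *\<^sub>R Bk y) (Proj_upto \<omega> Q k \<psi>))
            - (\<Sum>l\<in>{l. int k < \<bar>l\<bar> \<and> \<bar>l\<bar> \<le> int n}. U (mode_exp \<omega> B t l (P l \<psi>))))
      \<le> (onorm U + 1) * sqrt (\<Sum>\<^sub>\<infinity>l\<in>{l. \<bar>l\<bar> \<ge> int n + 1}.
              exp (2 * \<gamma> l * \<bar>t\<bar>) * ((norm (F \<psi> l))\<^sup>2 + (\<beta> l)\<^sup>2 * (norm \<psi>)\<^sup>2))"
      unfolding diff[symmetric] unfolding D_def R_def v_def q_def .

    have "infsum ?h R \<le> (\<Sum>\<^sub>\<infinity>l\<in>R. (exp (\<kappa> (n + 1) * \<bar>t\<bar>))\<^sup>2 * q l)"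
      by (rule infsum_mono[OF h summable_on_cmult_right[OF q] h_le])
    also have "\<dots> = (exp (\<kappa> (n + 1) * \<bar>t\<bar>))\<^sup>2 * infsum q R"
      by (rule infsum_cmult_right')
    finally have "sqrt (infsum ?h R) \<le> exp (\<kappa> (n + 1) * \<bar>t\<bar>) * sqrt (infsum q R)"
      using real_sqrt_le_mono by (fastforce simp: real_sqrt_mult)
    then have "(onorm U + 1) * sqrt (infsum ?h R)
        \<le> (onorm U + 1) * exp (\<kappa> (n + 1) * \<bar>t\<bar>) * sqrt (infsum q R)"
      using onorm_pos_le[OF U] by (simp add: mult.assoc)
    then show "(onorm U + 1) * sqrt (\<Sum>\<^sub>\<infinity>l\<in>{l. \<bar>l\<bar> \<ge> int n + 1}.
              exp (2 * \<gamma> l * \<bar>t\<bar>) * ((norm (F \<psi> l))\<^sup>2 + (\<beta> l)\<^sup>2 * (norm \<psi>)\<^sup>2))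
      \<le> (onorm U + 1) * exp (\<kappa> (n + 1) * \<bar>t\<bar>) * sqrt (\<Sum>\<^sub>\<infinity>l\<in>{l. \<bar>l\<bar> \<ge> int n + 1}.
              (norm (F \<psi> l))\<^sup>2 + (\<beta> l)\<^sup>2 * (norm \<psi>)\<^sup>2)"
      unfolding R_def q_def .
  qed
qed

end
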